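(* Let $p$ be a prime number and let $k \geq 2$ be an integer with $k - 1 = \langle e_0, \ldots, e_t \rangle_p$. Then there exist a $p$-tree $\mathcal{T}_p(k)$ of root $k - 1$ and a nonnegative integer $W_p(k)$ such that for all integers $n = \langle e_0, \ldots, e_t, d_{t+1}, \ldots, d_s \rangle_p$ and $r \in [t+1, s]$ we have: (i) if $\langle e_0, \ldots, e_t, d_{t+1}, \ldots, d_r \rangle_p \in \mathcal{T}_p(k)$, then $\nu_p(H(n,k)) \geq W_p(k) + r - ks + 1$; (ii) if $\langle e_0, \ldots, e_t, d_{t+1}, \ldots, d_r \rangle_p \in \mathcal{T}_p(k)^\star$, then $\nu_p(H(n,k)) = W_p(k) + r - ks$. Moreover, the girth of $\mathcal{T}_p(k)$ is less than $p^{0.835}$. In particular, the girth of $\mathcal{T}_2(k)$ is equal to $1$.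
   Context: For integers $n \geq k \geq 1$, $H(n,k) := \sum_{1 \leq i_1 < \cdots < i_k \leq n} \frac{1}{i_1 \cdots i_k}$. $\nu_p$ denotes the $p$-adic valuation on the rationals. For a prime $p$, the notation $\langle a_0, \ldots, a_v \rangle_p := \sum_{i=0}^v a_i p^{v-i}$ always means a base-$p$ representation, i.e. it implicitly requires $a_0, \ldots, a_v \in \{0, \ldots, p-1\}$ and $a_0 \neq 0$. A $p$-tree of root $\langle a_0, \ldots, a_v \rangle_p$ is a set $\mathcal{T}$ of positive integers such that: (T1) $\langle a_0, \ldots, a_v \rangle_p \in \mathcal{T}$; (T2) if $\langle b_0, \ldots, b_u \rangle_p \in \mathcal{T}$ then $u \geq v$ and $b_i = a_i$ for $i = 0, \ldots, v$; (T3) if $\langle b_0, \ldots, b_u \rangle_p \in \mathcal{T}$ and $u > v$ then $\langle b_0, \ldots, b_{u-1} \rangle_p \in \mathcal{T}$. A leaf of $\mathcal{T}$ is an integer $\langle b_0, \ldots, b_u \rangle_p$ with $u > v$ such that $\langle b_0, \ldots, b_{u-1} \rangle_p \in \mathcal{T}$ but $\langle b_0, \ldots, b_u \rangle_p \notin \mathcal{T}$; the set of leaves is $\mathcal{T}^\star$. The girth of $\mathcal{T}$ is the greatest integer $g$ such that for every $\langle b_0, \ldots, b_u \rangle_p \in \mathcal{T}$ we have $\langle b_0, \ldots, b_u, c \rangle_p \in \mathcal{T}$ for at least $g$ values of $c \in \{0, \ldots, p-1\}$. *)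

theory Defs
  imports "HOL-Computational_Algebra.Computational_Algebra" "HOL-Library.Sublist"
begin

function base_digits :: "nat \<Rightarrow> nat \<Rightarrow> nat list" where
  "base_digits p m = (if p < 2 \<or> m < p then [m] else base_digits p (m div p) @ [m mod p])"
  by pat_completeness auto
termination
  by (relation "measure (\<lambda>(p, m). m)") auto

declare base_digits.simps [simp del]

definition H :: "nat \<Rightarrow> nat \<Rightarrow> rat" where
  "H n k = (\<Sum>S | S \<subseteq> {1..n} \<and> card S = k. 1 / (\<Prod>i\<in>S. of_nat i))"

(* p-adic valuation on the rationals (value 0 at 0, irrelevant here) *)
definition padic_val_rat :: "nat \<Rightarrow> rat \<Rightarrow> int" where
  "padic_val_rat p q = (case quotient_of q of (a, b) \<Rightarrow>
      int (multiplicity (int p) a) - int (multiplicity (int p) b))"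

definition p_tree :: "nat \<Rightarrow> nat \<Rightarrow> nat set \<Rightarrow> bool" where
  "p_tree p R T \<longleftrightarrow>
     R \<in> T \<and>
     (\<forall>b\<in>T. b > 0 \<and> prefix (base_digits p R) (base_digits p b)) \<and>
     (\<forall>b\<in>T. length (base_digits p b) > length (base_digits p R) \<longrightarrow> b div p \<in> T)"

(* leaves of a p-tree of root R: \<langle>b_0..b_u\<rangle> with u > v, \<langle>b_0..b_{u-1}\<rangle> = x div p \<in> T, x \<notin> T *)
definition leaves :: "nat \<Rightarrow> nat \<Rightarrow> nat set \<Rightarrow> nat set" where
  "leaves p R T = {x. x > 0 \<and> length (base_digits p x) > length (base_digits p R) \<and>
                      x div p \<in> T \<and> x \<notin> T}"

definition girth :: "nat \<Rightarrow> nat set \<Rightarrow> nat" where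
  "girth p T = (GREATEST g. \<forall>b\<in>T. card {c. c < p \<and> b * p + c \<in> T} \<ge> g)"

end

(* If n has leading digits <e_0,...,e_t> = k - 1 and q further digits, then exactly k - 1 of the
numbers up to n are divisible by p^q. Hence a k-subset of {1..n} containing a number x has product
of valuation at most vtop q + v(x), where vtop q is the valuation of the product of those k - 1
multiples, and equality forces the subset to consist of them and x. Two congruences follow.

Dropping all subsets that contain a number not divisible by p^h shows that H n k agrees with
p^(-kh) * H (n div p^h) k up to valuation -vtop q - h + 1, so the first r digits of n alone decide
whether the valuation of H n k exceeds W + r - ks. The tree consists of the prefixes for which it does.

Appending a digit c to a node b adds, modulo higher valuation, a p-adic unit multiple of
1/(bp+1) + ... + 1/(bp+c). For p = 2 exactly one of the two digits cancels the given residue. In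
general, if c and c + d are both children, then c is a root modulo p of a nonzero polynomial of
degree d - 1, so the gap d occurs at most d - 1 times among the children; thus N children need
about N^(3/2) room, which makes N roughly p^(2/3). *)

theory Submission
  imports Defs
begin

section \<open>Digits\<close>

lemma foldl_base_digits: "p \<ge> 2 \<Longrightarrow> foldl (\<lambda>a d. a * p + d) 0 (base_digits p b) = b"
proof (induction p b rule: base_digits.induct)
  case (1 p b)
  then show ?case by (subst base_digits.simps) auto
qed

lemma base_digits_inj:
  assumes "p \<ge> 2" "base_digits p a = base_digits p b"
  shows "a = b"
  using assms foldl_base_digits by metis

lemma base_digits_nonempty [simp]: "base_digits p b \<noteq> []"
  by (subst base_digits.simps) auto

text \<open>With its converse below, this trades digit prefixes for equations
  \<open>b div p ^ q = R\<close>, the form used throughout. As \<open>R > 0\<close>, no quotient on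
  the way vanishes, so each division by \<open>p\<close> strips exactly one digit.\<close>

lemma base_digits_of_div:
  assumes "p \<ge> 2" "R > 0" "b div p ^ q = R"
  shows "prefix (base_digits p R) (base_digits p b) \<and>
         length (base_digits p b) = length (base_digits p R) + q"
  using assms(3)
proof (induction q arbitrary: b)
  case 0
  then show ?case by simp
next
  case (Suc q)
  have R: "(b div p) div p ^ q = R"
    using Suc.prems by (simp add: div_mult2_eq)
  have "\<not> b < p" using R assms(2) by (intro notI) auto
  then have "base_digits p b = base_digits p (b div p) @ [b mod p]"
    using assms(1) by (subst base_digits.simps) auto
  then show ?case using Suc.IH[OF R] by simp
qed

lemma prefix_base_digits_imp_div:
  assumes "p \<ge> 2" "prefix (base_digits p R) (base_digits p b)"
  shows "\<exists>q. b div p ^ q = R"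
  using assms
proof (induction p b rule: base_digits.induct)
  case (1 p b)
  show ?case
  proof (cases "b < p")
    case True
    then have "base_digits p b = [b]" by (subst base_digits.simps) auto
    with 1(3) have "base_digits p R = base_digits p b"
      by (metis base_digits_nonempty prefix_Cons prefix_Nil)
    then have "R = b" using base_digits_inj 1(2) by blast
    then show ?thesis by (intro exI[of _ 0]) simp
  next
    case False
    then have e: "base_digits p b = base_digits p (b div p) @ [b mod p]"
      using 1(2) by (subst base_digits.simps) auto
    from 1(3) have "base_digits p R = base_digits p b \<or> prefix (base_digits p R) (base_digits p (b div p))"
      unfolding e by (simp add: prefix_snoc)
    then show ?thesis
    proof
      assume "base_digits p R = base_digits p b"
      then have "R = b" using base_digits_inj 1(2) by blast
      then show ?thesis by (intro exI[of _ 0]) simp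
    next
      assume "prefix (base_digits p R) (base_digits p (b div p))"
      then obtain q where "b div p div p ^ q = R" using 1 False by force
      then show ?thesis by (intro exI[of _ "Suc q"]) (simp add: div_mult2_eq)
    qed
  qed
qed

section \<open>Gaps in finite sets\<close>

text \<open>The intervals \<open>[c, c + D)\<close> for \<open>c\<close> in \<open>A\<close> become disjoint after shortening each one at the
  next element of \<open>A\<close>; a gap \<open>d < D\<close> costs \<open>D - d\<close>.\<close>

lemma card_gaps_bound:
  fixes A :: "nat set"
  assumes "finite A" "A \<noteq> {}"
  shows "card A * D \<le> Max A + D + (\<Sum>d=1..<D. (D - d) * card {c. c \<in> A \<and> c + d \<in> A})"
  using assms
proof (induction A rule: finite_linorder_max_induct)
  case empty
  then show ?case by simp
next
  case (insert b A)
  let ?n = "\<lambda>A d. card {c. c \<in> A \<and> c + d \<in> A}"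
  let ?S = "\<lambda>A. \<Sum>d=1..<D. (D - d) * ?n A d"
  have fin: "finite {c. c \<in> insert b A \<and> c + d \<in> insert b A}" for d
    by (rule finite_subset[of _ "insert b A"]) (use insert in auto)
  have b: "b \<notin> A" using insert.hyps(2) by blast
  show ?case
  proof (cases "A = {}")
    case True
    then show ?thesis by simp
  next
    case False
    have Mx: "Max (insert b A) = b"
      using insert.hyps by (intro Max_eqI) (auto intro: less_imp_le)
    define g where "g = b - Max A"
    have MA: "Max A \<in> A" "Max A < b" using insert.hyps False by auto
    then have g: "g > 0" "Max A + g = b" unfolding g_def by auto
    have mono: "?n A d \<le> ?n (insert b A) d" for d
      using fin by (intro card_mono) auto
    have "?S A + (D - g) \<le> ?S (insert b A)"
    proof (cases "g < D")
      case True
      have "insert (Max A) {c. c \<in> A \<and> c + g \<in> A} \<subseteq> {c. c \<in> insert b A \<and> c + g \<in> insert b A}"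
        using MA g by auto
      from card_mono[OF fin this] have "?n A g + 1 \<le> ?n (insert b A) g"
        using g b insert.hyps(1) by (subst (asm) card_insert_disjoint) auto
      from mult_le_mono2[OF this, of "D - g"]
      have one: "(D - g) * ?n A g + (D - g) \<le> (D - g) * ?n (insert b A) g"
        by (simp only: distrib_left mult_1_right)
      have "?S A + (D - g) = ((D - g) * ?n A g + (D - g)) + (\<Sum>d\<in>{1..<D} - {g}. (D - d) * ?n A d)"
        using True g by (subst sum.remove[of _ g]) auto
      also have "\<dots> \<le> (D - g) * ?n (insert b A) g + (\<Sum>d\<in>{1..<D} - {g}. (D - d) * ?n (insert b A) d)"
        by (intro add_mono one sum_mono mult_le_mono2 mono)
      also have "\<dots> = ?S (insert b A)"
        using True g by (intro sum.remove[symmetric]) auto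
      finally show ?thesis .
    next
      case False
      then show ?thesis using mono by (auto intro!: sum_mono mult_le_mono2)
    qed
    moreover have "card (insert b A) * D = card A * D + D"
      using b insert.hyps(1) by simp
    moreover have "card A * D \<le> Max A + D + ?S A" using insert.IH False by blast
    ultimately show ?thesis unfolding Mx using g by linarith
  qed
qed

text \<open>These are the weights of \<open>card_gaps_bound\<close> for \<open>D = Suc m\<close>
  when a gap \<open>d\<close> occurs at most \<open>d - 1\<close> times. The closed form (m^3 - m) /
  6 is rearranged to stay in the naturals.\<close>

lemma sum_gap_weights: "6 * (\<Sum>d=1..<Suc m. (Suc m - d) * (d - 1)) + m = m ^ 3"
proof -
  have "6 * (\<Sum>d=1..<Suc m. (Suc m - d) * (d - 1)) = 6 * (\<Sum>i<m. (m - i) * i)"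
  proof -
    have "(\<Sum>d=1..<Suc m. (Suc m - d) * (d - 1)) = (\<Sum>i<m. (m - i) * i)"
      by (rule sum.reindex_bij_witness[of _ Suc "\<lambda>d. d - 1"]) auto
    then show ?thesis by simp
  qed
  moreover have "6 * (\<Sum>i<m. (m - i) * i) + m = m ^ 3"
  proof (induction m)
    case (Suc m)
    have "(\<Sum>i<Suc m. (Suc m - i) * i) = (\<Sum>i<m. (m - i) * i + i) + m"
      by (simp add: Suc_diff_le add.commute)
    also have "\<dots> = (\<Sum>i<m. (m - i) * i) + (\<Sum>i<Suc m. i)"
      by (simp add: sum.distrib)
    finally have "(\<Sum>i<Suc m. (Suc m - i) * i) = (\<Sum>i<m. (m - i) * i) + (\<Sum>i<Suc m. i)" .
    moreover have "2 * (\<Sum>i<Suc m. i) = m * Suc m" by (induction m) auto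
    ultimately have "6 * (\<Sum>i<Suc m. (Suc m - i) * i) = 6 * (\<Sum>i<m. (m - i) * i) + 3 * (m * Suc m)"
      by linarith
    with Suc.IH show ?case by (simp add: power3_eq_cube algebra_simps)
  qed simp
  ultimately show ?thesis by simp
qed

text \<open>\<open>D\<close> is the cube root of \<open>p\<close> rounded up. After division by
  \<open>D\<close>, the term \<open>p\<close> contributes at most p^(2/3) and \<open>S\<close> at
  most p^(2/3) / 6, so \<open>N\<close> is at most 7/6 * p^(2/3) + 1. This is below p^(5/6), and 5/6
  < 0.835.\<close>

lemma gap_bound_less_powr:
  fixes N D p :: nat
  assumes ND: "N * D \<le> (p - 1) + D + S" and S: "6 * S + (D - 1) = (D - 1) ^ 3"
    and D: "(D - 1) ^ 3 < p" "p \<le> D ^ 3" and p: "p \<ge> 11"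
  shows "real N < real p powr 0.835"
proof -
  \<comment> \<open>The sixth root turns p^(2/3) and p^(5/6) into \<open>x ^ 4\<close> and
    \<open>x ^ 5\<close>.\<close>
  define x where "x = real p powr (1 / 6)"
  have x6: "x ^ 6 = p" unfolding x_def using p by (simp add: powr_power)
  have x0: "x > 0" unfolding x_def using p by simp
  \<comment> \<open>1.49 lies just below the sixth root of 11 and is large enough for
    \<open>x ^ 4 * (x - 7 / 6) > 1\<close>.\<close>
  have "x > 1.49"
  proof (rule power_less_imp_less_base)
    show "1.49 ^ 6 < x ^ 6" unfolding x6 using p by (simp add: power_divide)
  qed (use x0 in simp)
  obtain m where m: "D = Suc m" using D p by (cases D) auto
  have "real m ^ 3 < (x\<^sup>2) ^ 3" using D(1) x6 m by (simp flip: power_mult of_nat_power)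
  then have mx: "real m < x\<^sup>2" by (rule power_less_imp_less_base) simp
  have "(x\<^sup>2) ^ 3 \<le> real D ^ 3" using D(2) x6 by (simp flip: power_mult of_nat_power)
  then have Dx: "x\<^sup>2 \<le> real D" using power_mono_iff[of "x\<^sup>2" "real D" 3] by simp
  have "real p * 1 \<le> x ^ 4 * real D"
    using mult_left_mono[OF Dx, of "x ^ 4"] x0 by (simp add: x6 flip: power_add)
  moreover have "6 * real S + real m = real m * (real m)\<^sup>2"
    using arg_cong[OF S, of real] m by (simp add: power3_eq_cube power2_eq_square)
  moreover have "(real m)\<^sup>2 \<le> x ^ 4" using power_mono[OF less_imp_le[OF mx], of 2] by simp
  then have "real m * (real m)\<^sup>2 \<le> real D * x ^ 4" using m by (intro mult_mono) auto
  moreover have "real N * real D \<le> real p + real D + real S"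
    using ND by (metis (no_types) of_nat_add of_nat_mult of_nat_le_iff diff_le_self add_le_mono1 order_trans)
  ultimately have "real N * real D \<le> (7 / 6 * x ^ 4 + 1) * real D"
    by (simp add: algebra_simps)
  then have "real N \<le> 7 / 6 * x ^ 4 + 1" using m by (simp only: mult_le_cancel_right)
  also have "\<dots> < x ^ 5"
  proof -
    have "1 < (1.49 ^ 4) * (1.49 - 7 / 6 :: real)" by (simp add: power_divide)
    also have "\<dots> \<le> x ^ 4 * (x - 7 / 6)"
      using \<open>x > 1.49\<close> by (intro mult_mono power_mono) auto
    finally show ?thesis by (simp add: algebra_simps eval_nat_numeral)
  qed
  also have "x ^ 5 = real p powr (5 / 6)" unfolding x_def using p by (simp add: powr_power)
  also have "\<dots> \<le> real p powr 0.835" using p by (intro powr_mono) auto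
  finally show ?thesis .
qed

text \<open>For small \<open>p\<close> it suffices that children are never adjacent. Taking sixth
  powers makes the comparison with p^(5/6) a finite check.\<close>

lemma half_Suc_less_powr:
  fixes N p :: nat
  assumes "2 * N \<le> p + 1" "p < 11" "p \<ge> 2"
  shows "real N < real p powr 0.835"
proof -
  have "((p + 1) / 2) ^ 6 < real p ^ 5"
  proof -
    have "p \<in> {2,3,4,5,6,7,8,9,10}" using assms by auto
    then show ?thesis by (auto simp: power_divide)
  qed
  also have "real p ^ 5 = (real p powr (5 / 6)) ^ 6" using assms by (simp add: powr_power)
  finally have "(p + 1) / 2 < real p powr (5 / 6)" by (rule power_less_imp_less_base) simp
  also have "\<dots> \<le> real p powr 0.835" using assms by (intro powr_mono) auto
  finally show ?thesis using assms(1) by simp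
qed

section \<open>Fractional ideals of the localization at a prime\<close>

context
  fixes p :: nat
  assumes p: "prime p"
begin

text \<open>Unlike \<open>padic_val_rat p x \<ge> e\<close>, membership in \<open>pideal e\<close> is also right for \<open>x = 0\<close>.\<close>

definition pideal :: "int \<Rightarrow> rat set" where
  "pideal e = {of_int a / of_int b * of_nat p powi e | a b. \<not> int p dvd b}"

lemma pidealI: "\<not> int p dvd b \<Longrightarrow> of_int a / of_int b * of_nat p powi e \<in> pideal e"
  unfolding pideal_def by blast

lemma pidealE:
  assumes "x \<in> pideal e"
  obtains a b where "\<not> int p dvd b" "b \<noteq> 0" "x = of_int a / of_int b * of_nat p powi e"
  using assms unfolding pideal_def by fastforce

lemma prime_int_p: "prime (int p)"
  using p by simp

lemma p_pos: "p > 0"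
  using p by (simp add: prime_gt_0_nat)

lemma pideal_zero [simp]: "0 \<in> pideal e"
  using pidealI[of 1 0 e] prime_int_p not_prime_unit by force

lemma pideal_add:
  assumes "x \<in> pideal e" "y \<in> pideal e"
  shows "x + y \<in> pideal e"
proof -
  obtain a b where x: "\<not> int p dvd b" "b \<noteq> 0" "x = of_int a / of_int b * of_nat p powi e"
    using assms(1) by (rule pidealE)
  obtain c d where y: "\<not> int p dvd d" "d \<noteq> 0" "y = of_int c / of_int d * of_nat p powi e"
    using assms(2) by (rule pidealE)
  have "x + y = of_int (a * d + c * b) / of_int (b * d) * of_nat p powi e"
    unfolding x(3) y(3) using x(2) y(2) by (simp add: field_simps)
  moreover have "\<not> int p dvd b * d"
    using x(1) y(1) prime_int_p by (simp add: prime_dvd_mult_iff)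
  ultimately show ?thesis using pidealI by presburger
qed

lemma pideal_mult:
  assumes "x \<in> pideal d" "y \<in> pideal e"
  shows "x * y \<in> pideal (d + e)"
proof -
  obtain a b where x: "\<not> int p dvd b" "b \<noteq> 0" "x = of_int a / of_int b * of_nat p powi d"
    using assms(1) by (rule pidealE)
  obtain a' b' where y: "\<not> int p dvd b'" "b' \<noteq> 0" "y = of_int a' / of_int b' * of_nat p powi e"
    using assms(2) by (rule pidealE)
  have "x * y = of_int (a * a') / of_int (b * b') * of_nat p powi (d + e)"
    unfolding x(3) y(3) using p_pos by (simp add: power_int_add)
  moreover have "\<not> int p dvd b * b'"
    using x(1) y(1) prime_int_p by (simp add: prime_dvd_mult_iff)
  ultimately show ?thesis using pidealI by presburger
qed

lemma of_int_in_pideal: "of_int a \<in> pideal 0"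
  using pidealI[of 1 a 0] prime_int_p not_prime_unit by force

lemma pideal_uminus: "x \<in> pideal e \<Longrightarrow> - x \<in> pideal e"
  using pideal_mult[OF of_int_in_pideal[of "-1"]] by force

lemma pideal_diff: "x \<in> pideal e \<Longrightarrow> y \<in> pideal e \<Longrightarrow> x - y \<in> pideal e"
  using pideal_add[OF _ pideal_uminus] by force

lemma pideal_sum: "(\<And>i. i \<in> A \<Longrightarrow> f i \<in> pideal e) \<Longrightarrow> sum f A \<in> pideal e"
  by (induction A rule: infinite_finite_induct) (auto intro: pideal_add)

lemma p_powi_in_pideal: "of_nat p powi e \<in> pideal e"
  using pidealI[of 1 1 e] prime_int_p not_prime_unit by force

lemma pideal_mono:
  assumes "d \<le> e" "x \<in> pideal e"
  shows "x \<in> pideal d"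
proof -
  have "of_nat p powi (e - d) = (of_int (int p ^ nat (e - d)) :: rat)"
    using assms(1) by (simp add: power_int_def)
  then have "of_nat p powi (e - d) \<in> pideal 0"
    by (metis of_int_in_pideal)
  from pideal_mult[OF this pideal_mult[OF assms(2) p_powi_in_pideal[of "d - e"]]]
  have "of_nat p powi (e - d) * (x * of_nat p powi (d - e)) \<in> pideal d" by simp
  moreover have "of_nat p powi (e - d) * (x * of_nat p powi (d - e)) = x"
    using p_pos power_int_add[of "of_nat p :: rat" "e - d" "d - e"] by (simp add: mult_ac)
  ultimately show ?thesis by simp
qed

lemma inverse_in_pideal:
  assumes "m > 0"
  shows "1 / of_nat m \<in> pideal (- int (multiplicity p m))"
proof -
  obtain m' where m': "m = p ^ multiplicity p m * m'" "\<not> p dvd m'"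
    using multiplicity_decompose'[of m p] assms p not_prime_unit by (metis neq0_conv)
  have "1 / of_nat m = (of_int 1 / of_int (int m') * of_nat p powi (- int (multiplicity p m)) :: rat)"
    by (subst m'(1)) (simp add: power_int_minus field_simps)
  moreover have "\<not> int p dvd int m'" using m'(2) by simp
  ultimately show ?thesis using pidealI by presburger
qed

lemma of_nat_in_pideal:
  assumes "p ^ e dvd m"
  shows "of_nat m \<in> pideal (int e)"
proof -
  obtain m' where "m = p ^ e * m'" using assms by blast
  then show ?thesis
    using pideal_mult[OF of_int_in_pideal[of "int m'"] p_powi_in_pideal[of "int e"]]
    by (simp add: mult_ac)
qed

lemma of_int_in_pideal_1_iff: "of_int a \<in> pideal 1 \<longleftrightarrow> int p dvd a"
proof
  assume "of_int a \<in> pideal 1"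
  then obtain c b where b: "\<not> int p dvd b" "b \<noteq> 0" "of_int a = (of_int c / of_int b * of_nat p powi 1 :: rat)"
    by (rule pidealE)
  then have "(of_int (a * b) :: rat) = of_int (c * int p)"
    by (simp add: field_simps)
  then have "a * b = c * int p" by (simp only: of_int_eq_iff)
  then have "int p dvd a * b" by simp
  then show "int p dvd a" using b(1) prime_int_p by (simp add: prime_dvd_mult_iff)
next
  assume "int p dvd a"
  then obtain c where "a = int p * c" by blast
  then show "of_int a \<in> pideal 1"
    using pideal_mult[OF of_int_in_pideal[of c] p_powi_in_pideal[of 1]] by (simp add: mult_ac)
qed

lemma pideal_scale_iff: "of_nat p powi d * x \<in> pideal (d + e) \<longleftrightarrow> x \<in> pideal e"
proof
  assume "of_nat p powi d * x \<in> pideal (d + e)"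
  from pideal_mult[OF p_powi_in_pideal[of "-d"] this] show "x \<in> pideal e"
    using p_pos by (simp add: power_int_minus mult.assoc[symmetric])
qed (intro pideal_mult p_powi_in_pideal)

text \<open>Write \<open>x\<close> as p^v times a quotient of integers prime to p; membership in
  \<open>pideal (v + 1)\<close> would make the numerator divisible by p. Zero is excluded because it
  lies in every \<open>pideal e\<close> while its \<open>padic_val_rat\<close> is 0.\<close>

lemma pideal_iff_padic_val:
  assumes "x \<noteq> 0"
  shows "x \<in> pideal e \<longleftrightarrow> e \<le> padic_val_rat p x"
proof -
  obtain a b where ab: "quotient_of x = (a, b)" by fastforce
  then have x: "x = of_int a / of_int b" and b: "b > 0"
    using quotient_of_div quotient_of_denom_pos by auto
  from x assms have a: "a \<noteq> 0" by auto
  have nu: "\<not> is_unit (int p)" using prime_int_p not_prime_unit by blast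
  obtain a' where a': "a = int p ^ multiplicity (int p) a * a'" "\<not> int p dvd a'"
    using multiplicity_decompose'[of a "int p"] a nu by metis
  obtain b' where b': "b = int p ^ multiplicity (int p) b * b'" "\<not> int p dvd b'"
    using multiplicity_decompose'[of b "int p"] b nu by (metis less_irrefl)
  define v where "v = padic_val_rat p x"
  have v: "v = int (multiplicity (int p) a) - int (multiplicity (int p) b)"
    unfolding v_def padic_val_rat_def ab by simp
  have x': "x = of_int a' / of_int b' * of_nat p powi v"
    unfolding x v using p_pos
    by (subst a'(1), subst b'(1)) (simp add: power_int_diff mult_ac)
  have b'0: "b' \<noteq> 0" using b'(2) by auto
  have in_v: "x \<in> pideal v" unfolding x' using b'(2) by (rule pidealI)
  have "e \<le> v" if "x \<in> pideal e"
  proof (rule ccontr)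
    assume "\<not> e \<le> v"
    then have "x \<in> pideal (v + 1)" using that by (intro pideal_mono[of "v + 1" e]) auto
    then have "of_int a' / of_int b' \<in> pideal 1"
      unfolding x' using pideal_scale_iff[of v "of_int a' / of_int b'" 1] by (simp only: mult.commute)
    from pideal_mult[OF of_int_in_pideal[of b'] this]
    have "of_int a' \<in> pideal 1" using b'0 by simp
    with a'(2) show False by (simp add: of_int_in_pideal_1_iff)
  qed
  with in_v pideal_mono show ?thesis unfolding v_def[symmetric] by blast
qed

section \<open>Coincidences of harmonic sums modulo a prime\<close>

text \<open>Lagrange's bound for roots over the field of \<open>p\<close> elements, kept in integer
  polynomials. Tracking the coefficient at \<open>n\<close> lets synthetic division carry the
  hypothesis from \<open>Suc n\<close> down to \<open>n\<close>.\<close>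

lemma card_poly_roots_mod:
  fixes f :: "int poly"
  assumes "degree f \<le> n" "\<not> int p dvd coeff f n"
  shows "card {c. c < p \<and> int p dvd poly f (a + int c)} \<le> n"
  using assms
proof (induction n arbitrary: f)
  case 0
  then obtain x where "f = [:x:]" by (metis degree_eq_zeroE le_zero_eq)
  with 0 show ?case by simp
next
  case (Suc n)
  let ?Z = "\<lambda>f. {c. c < p \<and> int p dvd poly f (a + int c)}"
  show ?case
  proof (cases "?Z f = {}")
    case True
    then show ?thesis by (metis card.empty le0)
  next
    case False
    then obtain c where c: "c < p" "int p dvd poly f (a + int c)" by blast
    let ?a = "a + int c"
    define g where "g = synthetic_div f ?a"
    have eq: "f + smult ?a g = pCons (poly f ?a) g"
      unfolding g_def by (rule synthetic_div_correct)
    have ev: "poly f x = poly f ?a + (x - ?a) * poly g x" for x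
      using arg_cong[OF eq, of "\<lambda>h. poly h x"] by (simp add: algebra_simps)
    have dg: "degree g \<le> n"
      unfolding g_def using Suc.prems(1) by (simp add: degree_synthetic_div)
    have "coeff g (Suc n) = 0" using dg by (simp add: coeff_eq_0)
    with arg_cong[OF eq, of "\<lambda>h. coeff h (Suc n)"] have "coeff f (Suc n) = coeff g n"
      by simp
    with Suc.prems(2) have IH: "card (?Z g) \<le> n" by (intro Suc.IH dg) simp
    have "?Z f \<subseteq> insert c (?Z g)"
    proof
      fix x assume "x \<in> ?Z f"
      then have x: "x < p" "int p dvd poly f (a + int x)" by auto
      have "int p dvd (int x - int c) * poly g (a + int x)"
        using x(2) c(2) unfolding ev[of "a + int x"] by (simp add: dvd_add_right_iff)
      then have "int p dvd int x - int c \<or> int p dvd poly g (a + int x)"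
        using prime_int_p by (simp add: prime_dvd_mult_iff)
      moreover have "x = c" if "int p dvd int x - int c"
        using that x(1) c(1) dvd_imp_le_int[of "int x - int c" "int p"] by (cases "x = c") auto
      ultimately show "x \<in> insert c (?Z g)" using x(1) by auto
    qed
    then have "card (?Z f) \<le> card (insert c (?Z g))" by (intro card_mono) auto
    also have "\<dots> \<le> Suc n" using IH card_insert_le_m1[of "Suc n" "?Z g" c] by simp
    finally show ?thesis .
  qed
qed

text \<open>Clearing denominators turns the sum into the derivative of \<open>(X + 1) \<dots> (X + d)\<close>,
  whose leading coefficient is \<open>d\<close>.\<close>

lemma card_harmonic_window_mod:
  assumes "0 < d" "d < p" "p dvd a"
  shows "card {c. c + d < p \<and> (\<Sum>j=1..d. 1 / of_nat (a + c + j)) \<in> pideal 1} \<le> d - 1"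
proof -
  define F :: "int poly" where "F = (\<Prod>j=1..d. [:int j, 1:])"
  have monic: "lead_coeff F = 1"
    unfolding F_def by (subst lead_coeff_prod) (simp add: lead_coeff_pCons)
  have deg: "degree F = d"
    unfolding F_def by (subst degree_prod_eq_sum_degree) auto
  have dF: "pderiv F = (\<Sum>j=1..d. \<Prod>i\<in>{1..d} - {j}. [:int i, 1:])"
    unfolding F_def by (subst pderiv_prod) (simp add: pderiv_pCons)
  have lc: "coeff (pderiv F) (d - 1) = int d"
    using monic deg assms(1) by (simp add: coeff_pderiv)
  have "int p dvd poly (pderiv F) (int a + int c)"
    if c: "c + d < p" and s: "(\<Sum>j=1..d. 1 / of_nat (a + c + j)) \<in> pideal 1" for c
  proof -
    have "of_int (poly (pderiv F) (int a + int c)) =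
        (\<Sum>j=1..d. \<Prod>i\<in>{1..d} - {j}. (of_nat (a + c + i) :: rat))"
      unfolding dF by (simp add: poly_sum poly_prod add_ac)
    also have "\<dots> = (\<Sum>j=1..d. 1 / of_nat (a + c + j) * (\<Prod>i=1..d. of_nat (a + c + i)))"
    proof (intro sum.cong refl)
      fix j assume "j \<in> {1..d}"
      moreover from this have "(of_nat (a + c + j) :: rat) \<noteq> 0"
        by (subst of_nat_eq_0_iff) simp
      ultimately show "(\<Prod>i\<in>{1..d} - {j}. (of_nat (a + c + i) :: rat)) =
          1 / of_nat (a + c + j) * (\<Prod>i=1..d. of_nat (a + c + i))"
        by (subst prod.remove[of "{1..d}" j]) simp_all
    qed
    also have "\<dots> = (\<Sum>j=1..d. 1 / of_nat (a + c + j)) * of_int (int (\<Prod>i=1..d. a + c + i))"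
      by (simp add: sum_distrib_right)
    finally have "of_int (poly (pderiv F) (int a + int c)) \<in> pideal (1 + 0)"
      using pideal_mult[OF s of_int_in_pideal] by presburger
    then show ?thesis by (simp add: of_int_in_pideal_1_iff)
  qed
  then have "card {c. c + d < p \<and> (\<Sum>j=1..d. 1 / of_nat (a + c + j)) \<in> pideal 1}
      \<le> card {c. c < p \<and> int p dvd poly (pderiv F) (int a + int c)}"
    by (intro card_mono) auto
  also have "\<dots> \<le> d - 1"
  proof (rule card_poly_roots_mod)
    show "degree (pderiv F) \<le> d - 1" by (simp add: degree_pderiv deg)
    show "\<not> int p dvd coeff (pderiv F) (d - 1)"
      unfolding lc using assms by (auto dest: zdvd_imp_le)
  qed
  finally show ?thesis .
qed

section \<open>Valuations of the terms of \<open>H n k\<close>\<close>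

lemma multiplicity_prod_nat:
  assumes "finite S" "0 \<notin> S"
  shows "multiplicity p (\<Prod>S) = (\<Sum>i\<in>S. multiplicity p i)"
  using assms p by (subst prime_elem_multiplicity_prod_distrib) auto

lemma inverse_prod_in_pideal:
  assumes "S \<subseteq> {1..n}"
  shows "1 / (\<Prod>i\<in>S. of_nat i) \<in> pideal (- int (\<Sum>i\<in>S. multiplicity p i))"
proof -
  have S: "finite S" "0 \<notin> S" using assms finite_subset[of S "{1..n}"] by auto
  then have "i > 0" if "i \<in> S" for i using that by (cases i) auto
  then have "\<Prod>S > 0" by (simp add: prod_pos)
  from inverse_in_pideal[OF this] show ?thesis
    using multiplicity_prod_nat[OF S] by simp
qed

text \<open>Guarantees that the valuation of \<open>H n k\<close> is a genuine one, not the default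
  value at 0.\<close>

lemma H_pos:
  assumes "k \<le> n"
  shows "H n k > 0"
  unfolding H_def
proof (rule sum_pos)
  show "finite {S. S \<subseteq> {1..n} \<and> card S = k}"
    by (rule finite_subset[of _ "Pow {1..n}"]) auto
  have "{1..k} \<in> {S. S \<subseteq> {1..n} \<and> card S = k}" using assms by auto
  then show "{S. S \<subseteq> {1..n} \<and> card S = k} \<noteq> {}" by blast
  fix S assume "S \<in> {S. S \<subseteq> {1..n} \<and> card S = k}"
  then have "i > 0" if "i \<in> S" for i using that by fastforce
  then show "1 / (\<Prod>i\<in>S. of_nat i) > (0 :: rat)" by (simp add: prod_pos)
qed

lemma H_eq_0:
  assumes "n < k"
  shows "H n k = 0"
proof -
  have "card S \<noteq> k" if "S \<subseteq> {1..n}" for S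
    using card_mono[OF _ that] assms by simp
  then have "{S. S \<subseteq> {1..n} \<and> card S = k} = {}" by blast
  then show ?thesis unfolding H_def by (simp only: sum.empty)
qed

text \<open>Division by p^h matches k-subsets of multiples of p^h up to \<open>n\<close> with
  k-subsets of \<open>{1..n div p ^ h}\<close>; each of the \<open>k\<close> factors of a product
  releases one p^h.\<close>

lemma sum_multiples_eq:
  "(\<Sum>S | S \<subseteq> {1..n} \<and> card S = k \<and> (\<forall>x\<in>S. p ^ h dvd x). 1 / (\<Prod>i\<in>S. of_nat i)) =
    of_nat p powi (- int (k * h)) * H (n div p ^ h) k"
proof -
  have ph: "p ^ h > 0" using p_pos by simp
  have inj: "inj_on ((*) (p ^ h)) S" for S using p_pos by (auto simp: inj_on_def)
  have "(\<Sum>S | S \<subseteq> {1..n} \<and> card S = k \<and> (\<forall>x\<in>S. p ^ h dvd x). 1 / (\<Prod>i\<in>S. of_nat i)) =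
      (\<Sum>S | S \<subseteq> {1..n div p ^ h} \<and> card S = k.
        of_nat p powi (- int (k * h)) * (1 / (\<Prod>i\<in>S. of_nat i) :: rat))"
  proof (rule sum.reindex_bij_witness[of _ "\<lambda>S. (*) (p ^ h) ` S" "\<lambda>S. (\<lambda>x. x div p ^ h) ` S"], goal_cases)
    case (1 S)
    then have "(\<lambda>x. p ^ h * (x div p ^ h)) ` S = id ` S" by (intro image_cong) auto
    then show ?case by (simp add: image_image)
  next
    case (2 S)
    then have "inj_on (\<lambda>x. x div p ^ h) S"
      by (intro inj_on_inverseI[of _ "(*) (p ^ h)"]) auto
    then have "card ((\<lambda>x. x div p ^ h) ` S) = k" using 2 by (simp add: card_image)
    moreover have "x div p ^ h \<in> {1..n div p ^ h}" if "x \<in> S" for x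
    proof -
      have "x \<in> {1..n}" "p ^ h dvd x" using 2 that by auto
      then show ?thesis using ph by (auto simp: div_le_mono Suc_le_eq div_greater_zero_iff dvd_imp_le)
    qed
    ultimately show ?case by auto
  next
    case (3 S)
    then show ?case using p_pos by (simp add: image_image)
  next
    case (4 S)
    have "p ^ h * x \<in> {1..n}" if "x \<in> S" for x
    proof -
      have "x \<in> {1..n div p ^ h}" using 4 that by auto
      then have "x * p ^ h \<le> n" "x \<ge> 1" using ph by (auto simp: less_eq_div_iff_mult_less_eq)
      then show ?thesis using ph by (simp add: mult.commute Suc_le_eq)
    qed
    then show ?case using 4 by (auto simp: card_image[OF inj])
  next
    case (5 S)
    define B where "B = (\<lambda>x. x div p ^ h) ` S"
    have "(\<lambda>x. p ^ h * (x div p ^ h)) ` S = id ` S" using 5 by (intro image_cong) auto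
    then have S: "S = (*) (p ^ h) ` B" unfolding B_def by (simp add: image_image)
    have "card B = k" using 5 by (simp add: S card_image[OF inj])
    then have "(\<Prod>i\<in>S. of_nat i) = (of_nat p ^ (k * h) * (\<Prod>i\<in>B. of_nat i) :: rat)"
      unfolding S by (subst prod.reindex[OF inj])
        (simp add: prod.distrib mult.commute[of k] flip: power_mult)
    then show ?case unfolding B_def[symmetric] by (simp add: power_int_minus field_simps del: of_nat_mult)
  qed
  then show ?thesis unfolding H_def by (simp add: sum_distrib_left)
qed

section \<open>The k - 1 multiples of p^q up to n\<close>

context
  fixes k :: nat
  assumes k: "k \<ge> 2"
begin

text \<open>No \<open>n\<close> occurs here: whenever \<open>n div p ^ q = k - 1\<close>, these are
  all the multiples of p^q in \<open>{1..n}\<close>, so siblings share the set.\<close>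

definition tops :: "nat \<Rightarrow> nat set" where
  "tops q = (*) (p ^ q) ` {1..k - 1}"

definition vtop :: "nat \<Rightarrow> nat" where
  "vtop q = (k - 1) * q + multiplicity p (fact (k - 1) :: nat)"

lemma vtop_add: "vtop (q + h) = vtop q + (k - 1) * h"
  unfolding vtop_def by (simp add: distrib_left)

lemma inj_tops: "inj_on ((*) (p ^ q)) A"
  using p_pos by (auto simp: inj_on_def)

lemma finite_tops [simp]: "finite (tops q)"
  and card_tops: "card (tops q) = k - 1"
  and prod_tops: "\<Prod>(tops q) = p ^ (q * (k - 1)) * fact (k - 1)"
  unfolding tops_def
  by (simp_all add: card_image[OF inj_tops] prod.reindex[OF inj_tops] prod.distrib fact_prod
      flip: power_mult)

lemma zero_notin_tops: "0 \<notin> tops q"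
  unfolding tops_def using p_pos by auto

lemma multiplicity_prod_tops: "multiplicity p (\<Prod>(tops q)) = vtop q"
  unfolding prod_tops vtop_def using p p_pos not_prime_unit
  by (subst prime_elem_multiplicity_mult_distrib) (auto simp: multiplicity_same_power mult.commute)

lemma tops_eq:
  assumes "n div p ^ q = k - 1"
  shows "tops q = {x \<in> {1..n}. q \<le> multiplicity p x}"
proof -
  have ph: "p ^ q > 0" using p_pos by simp
  have "x \<in> tops q \<longleftrightarrow> x \<in> {1..n} \<and> p ^ q dvd x" for x
  proof
    assume "x \<in> tops q"
    then obtain i where "x = p ^ q * i" "i \<in> {1..k - 1}"
      unfolding tops_def by blast
    then have i: "x = p ^ q * i" "1 \<le> i" "i \<le> n div p ^ q"
      unfolding assms by auto
    then have "i * p ^ q \<le> n" using ph by (simp add: less_eq_div_iff_mult_less_eq)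
    with i ph show "x \<in> {1..n} \<and> p ^ q dvd x" by (simp add: mult.commute Suc_le_eq)
  next
    assume x: "x \<in> {1..n} \<and> p ^ q dvd x"
    then have "x = p ^ q * (x div p ^ q)" "x div p ^ q \<in> {1..k - 1}"
      using ph unfolding assms[symmetric]
      by (auto simp: div_le_mono Suc_le_eq div_greater_zero_iff dvd_imp_le)
    then show "x \<in> tops q" unfolding tops_def by blast
  qed
  moreover have "p ^ q dvd x \<longleftrightarrow> q \<le> multiplicity p x" if "x \<in> {1..n}" for x
    using that p not_prime_unit by (subst power_dvd_iff_le_multiplicity) auto
  ultimately show ?thesis by blast
qed

text \<open>Exchanging elements of \<open>tops q\<close> for other numbers loses at least one
  unit of valuation per exchange.\<close>

lemma sum_multiplicity_le:
  assumes n: "n div p ^ q = k - 1" and S: "S \<subseteq> {1..n}" "card S = k" and x: "x \<in> S"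
  shows "(\<Sum>i\<in>S. multiplicity p i) + card (tops q - (S - {x})) \<le> vtop q + multiplicity p x"
proof -
  let ?v = "multiplicity p" and ?M = "tops q" and ?B = "S - {x}"
  have fin: "finite S" using S(1) finite_subset by blast
  then have cB: "card ?B = card ?M" using S x by (simp add: card_tops)
  have cd: "card (?B - ?M) = card (?M - ?B)"
    using cB fin by (simp add: card_le_sym_Diff le_antisym)
  \<comment> \<open>Valuations are at most q - 1 outside \<open>tops q\<close> and at least q
    inside; the two set differences have equal size, so every exchange costs a unit.\<close>
  have "sum ?v (?B - ?M) + card (?B - ?M) = (\<Sum>i\<in>?B - ?M. ?v i + 1)"
    by (simp only: sum.distrib card_eq_sum)
  also have "\<dots> \<le> (\<Sum>i\<in>?B - ?M. q)"
    using S(1) by (intro sum_mono) (auto simp: tops_eq[OF n])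
  also have "\<dots> = (\<Sum>i\<in>?M - ?B. q)" using cd by simp
  also have "\<dots> \<le> sum ?v (?M - ?B)"
    by (intro sum_mono) (auto simp: tops_eq[OF n])
  finally have "sum ?v (?B - ?M) + card (?M - ?B) \<le> sum ?v (?M - ?B)" using cd by simp
  moreover have "sum ?v ?B = sum ?v (?B \<inter> ?M) + sum ?v (?B - ?M)"
    using fin by (subst sum.Int_Diff[of _ _ ?M]) auto
  moreover have "sum ?v ?M = sum ?v (?B \<inter> ?M) + sum ?v (?M - ?B)"
    by (subst sum.Int_Diff[of _ _ ?B]) (auto simp: Int_commute)
  moreover have "sum ?v ?M = vtop q"
    using multiplicity_prod_tops multiplicity_prod_nat[OF finite_tops zero_notin_tops] by simp
  moreover have "sum ?v S = ?v x + sum ?v ?B"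
    using fin x by (rule sum.remove)
  ultimately show ?thesis by linarith
qed

text \<open>The right side of the last assumption counts the exchanges. The congruences below gain
  precision either from a small valuation of \<open>x\<close> or from a positive count.\<close>

lemma term_in_pideal:
  assumes "n div p ^ q = k - 1" "S \<subseteq> {1..n}" "card S = k" "x \<in> S"
    and "e + int (vtop q + multiplicity p x) \<le> int (card (tops q - (S - {x})))"
  shows "1 / (\<Prod>i\<in>S. of_nat i) \<in> pideal e"
  using sum_multiplicity_le[OF assms(1-4)] assms(5)
  by (intro pideal_mono[OF _ inverse_prod_in_pideal[OF assms(2)]]) linarith

section \<open>Two congruences for H: removing digits and raising the last digit\<close>

lemma H_div_congruence:
  assumes n: "n div p ^ q = k - 1" and h: "h \<le> q"
  shows "H n k - of_nat p powi (- int (k * h)) * H (n div p ^ h) k \<in> pideal (1 - int (vtop q) - int h)"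
proof -
  let ?A = "{S. S \<subseteq> {1..n} \<and> card S = k}"
  let ?G = "{S. S \<subseteq> {1..n} \<and> card S = k \<and> (\<forall>x\<in>S. p ^ h dvd x)}"
  have fin: "finite ?A" by (rule finite_subset[of _ "Pow {1..n}"]) auto
  have "H n k - of_nat p powi (- int (k * h)) * H (n div p ^ h) k =
      (\<Sum>S\<in>?A - ?G. 1 / (\<Prod>i\<in>S. of_nat i))"
    unfolding sum_multiples_eq[symmetric] H_def[of n]
    by (subst sum_diff[OF fin]) auto
  also have "\<dots> \<in> pideal (1 - int (vtop q) - int h)"
  proof (rule pideal_sum)
    fix S assume "S \<in> ?A - ?G"
    then obtain x where S: "S \<subseteq> {1..n}" "card S = k" and x: "x \<in> S" "\<not> p ^ h dvd x" by blast
    \<comment> \<open>The valuation of \<open>x\<close> is at most h - 1, which is the source of the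
      1 in the exponent.\<close>
    have "multiplicity p x < h" using x(2) multiplicity_dvd' by (meson not_less)
    then show "1 / (\<Prod>i\<in>S. of_nat i) \<in> pideal (1 - int (vtop q) - int h)"
      by (intro term_in_pideal[OF n S x(1)]) linarith
  qed
  finally show ?thesis .
qed

lemma H_add_congruence:
  assumes n: "n div p ^ q = k - 1" and n': "n' div p ^ q = k - 1" and "n \<le> n'" and q: "q \<ge> 1"
    and ndvd: "\<And>x. n < x \<Longrightarrow> x \<le> n' \<Longrightarrow> \<not> p dvd x"
  shows "H n' k - H n k - 1 / of_nat (\<Prod>(tops q)) * (\<Sum>x\<in>{n<..n'}. 1 / of_nat x)
    \<in> pideal (1 - int (vtop q))"
proof -
  let ?A = "\<lambda>n :: nat. {S. S \<subseteq> {1..n} \<and> card S = k}"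
  let ?M = "tops q" and ?f = "\<lambda>S. 1 / (\<Prod>i\<in>S. of_nat i) :: rat"
  have fin: "finite (?A n)" for n by (rule finite_subset[of _ "Pow {1..n}"]) auto
  \<comment> \<open>\<open>tops q\<close> already fits below \<open>n\<close>, so for
    \<open>x\<close> beyond \<open>n\<close> the set \<open>insert x (tops q)\<close> is a k-subset
    that is new at \<open>n'\<close>.\<close>
  have M: "?M \<subseteq> {1..n}" unfolding tops_eq[OF n] by auto
  have notM: "x \<notin> ?M" if "x \<in> {n<..n'}" for x using M that by auto
  define G where "G = (\<lambda>x. insert x ?M) ` {n<..n'}"
  have inj: "inj_on (\<lambda>x. insert x ?M) {n<..n'}"
  proof (rule inj_onI)
    fix x y assume "x \<in> {n<..n'}" "y \<in> {n<..n'}" "insert x ?M = insert y ?M"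
    then show "x = y" using notM by blast
  qed
  have sub: "?A n \<subseteq> ?A n'" using \<open>n \<le> n'\<close> by auto
  have G: "G \<subseteq> ?A n' - ?A n"
    unfolding G_def using M \<open>n \<le> n'\<close> k notM by (fastforce simp: card_tops)
  have "sum ?f G = (\<Sum>x\<in>{n<..n'}. 1 / (of_nat x * (\<Prod>i\<in>?M. of_nat i)))"
    unfolding G_def using notM by (simp add: sum.reindex[OF inj])
  also have "\<dots> = 1 / of_nat (\<Prod>?M) * (\<Sum>x\<in>{n<..n'}. 1 / of_nat x)"
    by (simp add: sum_distrib_left mult.commute)
  finally have "H n' k - H n k - 1 / of_nat (\<Prod>?M) * (\<Sum>x\<in>{n<..n'}. 1 / of_nat x) =
      sum ?f (?A n' - ?A n - G)"
    unfolding H_def using sum_diff[OF fin sub, of ?f] sum_diff[OF _ G, of ?f] fin by simp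
  also have "\<dots> \<in> pideal (1 - int (vtop q))"
  proof (rule pideal_sum)
    fix S assume "S \<in> ?A n' - ?A n - G"
    then have S: "S \<subseteq> {1..n'}" "card S = k" "\<not> S \<subseteq> {1..n}" "S \<notin> G" by auto
    then obtain x where x: "x \<in> S" "x \<in> {n<..n'}" by force
    have fS: "finite S" using S(1) finite_subset by blast
    have vx: "multiplicity p x = 0" using x(2) ndvd by (intro not_dvd_imp_multiplicity_0) auto
    \<comment> \<open>A new subset outside \<open>G\<close> misses some member of
      \<open>tops q\<close>; that exchange gains one unit, and \<open>x\<close> itself has valuation
      0.\<close>
    have "S - {x} \<noteq> ?M"
    proof
      assume "S - {x} = ?M"
      then have "S = insert x ?M" using x(1) by blast
      then show False using S(4) x(2) unfolding G_def by blast
    qed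
    moreover have "card (S - {x}) = card ?M" using x S fS by (simp add: card_tops)
    ultimately have "\<not> ?M \<subseteq> S - {x}" using fS card_subset_eq[of "S - {x}" ?M] by auto
    then have "card (?M - (S - {x})) > 0" by (simp add: card_gt_0_iff)
    then show "?f S \<in> pideal (1 - int (vtop q))"
      by (intro term_in_pideal[OF n' S(1,2) x(1)]) (simp add: vx)
  qed
  finally show ?thesis .
qed

section \<open>The tree\<close>

text \<open>In the notation of the theorem \<open>q = r - t\<close>, and \<open>- vtop q = W + r - k * r\<close> is the
  valuation prescribed for the leaves of this level. The root belongs to the set with \<open>q = 0\<close>, because
  \<open>H (k - 1) k = 0\<close>.\<close>

definition tree :: "nat set" where
  "tree = {m. \<exists>q. m div p ^ q = k - 1 \<and> H m k \<in> pideal (1 - int (vtop q))}"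

lemma p_ge_2: "p \<ge> 2"
  using p by (rule prime_ge_2_nat)

lemma digits_of_level:
  assumes "m div p ^ q = k - 1"
  shows "prefix (base_digits p (k - 1)) (base_digits p m)"
    and "length (base_digits p m) = length (base_digits p (k - 1)) + q"
  using base_digits_of_div[OF p_ge_2 _ assms] k by auto

text \<open>The number of digits fixes the level, so the existential in \<open>tree\<close> has only
  one candidate \<open>q\<close>.\<close>

lemma mem_tree_iff:
  assumes "m div p ^ q = k - 1"
  shows "m \<in> tree \<longleftrightarrow> H m k \<in> pideal (1 - int (vtop q))"
proof -
  have "q' = q" if "m div p ^ q' = k - 1" for q'
    using digits_of_level(2)[OF assms] digits_of_level(2)[OF that] by simp
  then show ?thesis using assms unfolding tree_def by blast
qed

text \<open>The case \<open>e = 1\<close> is the condition for the tree, and \<open>e = 0\<close> is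
  the bound that a leaf still meets. Beyond \<open>e = 1\<close> the error of the congruence is no
  longer controlled.\<close>

lemma H_div_iff:
  assumes n: "n div p ^ (q + h) = k - 1" and e: "e \<le> 1"
  shows "H n k \<in> pideal (e - int (vtop q) - int (k * h)) \<longleftrightarrow> H (n div p ^ h) k \<in> pideal (e - int (vtop q))"
proof -
  let ?I = "pideal (e - int (vtop q) - int (k * h))"
  let ?y = "of_nat p powi (- int (k * h)) * H (n div p ^ h) k"
  \<comment> \<open>By this identity the error exponent at level \<open>q + h\<close> is exactly the
    exponent for \<open>e = 1\<close> after scaling by p^(-kh).\<close>
  have "int (k - 1) * int h + int h = int (k * h)"
    using k by (simp add: of_nat_diff left_diff_distrib)
  then have "1 - int (vtop (q + h)) - int h = 1 - int (vtop q) - int (k * h)"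
    by (simp add: vtop_add)
  then have d: "H n k - ?y \<in> ?I"
    using H_div_congruence[OF n, of h] e by (intro pideal_mono[of "e - int (vtop q) - int (k * h)"]) auto
  have "H n k \<in> ?I \<longleftrightarrow> ?y \<in> ?I"
    using pideal_diff[OF _ d, of "H n k"] pideal_add[OF d, of ?y] by auto
  also have "?y \<in> ?I \<longleftrightarrow> H (n div p ^ h) k \<in> pideal (e - int (vtop q))"
    using pideal_scale_iff[of "- int (k * h)" _ "e - int (vtop q)"] by simp
  finally show ?thesis .
qed

lemma vtop_Suc: "int (vtop (Suc q)) = int (vtop q) + int k - 1"
  using vtop_add[of q 1] k by (simp add: of_nat_diff)

text \<open>A child of a node is at most one unit short of being a node, which pins down the
  valuation at a leaf.\<close>

lemma child_in_pideal:
  assumes "n div p \<in> tree" "n div p ^ Suc q = k - 1"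
  shows "H n k \<in> pideal (- int (vtop (Suc q)))"
proof -
  have "(n div p) div p ^ q = k - 1" using assms(2) by (simp add: div_mult2_eq)
  with assms(1) have "H (n div p) k \<in> pideal (1 - int (vtop q))" by (simp add: mem_tree_iff)
  then have "H n k \<in> pideal (1 - int (vtop q) - int (k * 1))"
    using H_div_iff[of n q 1 1] assms(2) by simp
  then show ?thesis by (simp add: vtop_Suc diff_diff_eq)
qed

lemma root_in_tree: "k - 1 \<in> tree"
  using k by (subst mem_tree_iff[of _ 0]) (auto simp: H_eq_0)

lemma p_tree_tree: "p_tree p (k - 1) tree"
  unfolding p_tree_def
proof (intro conjI ballI impI root_in_tree)
  fix b assume "b \<in> tree"
  then obtain q where q: "b div p ^ q = k - 1" and b: "H b k \<in> pideal (1 - int (vtop q))"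
    unfolding tree_def by blast
  show "b > 0" using q k by (intro gr0I) auto
  show "prefix (base_digits p (k - 1)) (base_digits p b)" by (rule digits_of_level(1)[OF q])
  assume "length (base_digits p (k - 1)) < length (base_digits p b)"
  then obtain q' where q': "q = Suc q'" using digits_of_level(2)[OF q] by (cases q) auto
  then have d: "(b div p) div p ^ q' = k - 1" using q by (simp add: div_mult2_eq)
  \<comment> \<open>The condition at \<open>b\<close> exceeds by one unit what its parent needs
    after scaling.\<close>
  have "H b k \<in> pideal (1 - int (vtop q') - int (k * 1))"
    by (rule pideal_mono[OF _ b]) (simp add: q' vtop_Suc)
  then have "H (b div p) k \<in> pideal (1 - int (vtop q'))"
    using H_div_iff[of b q' 1 1] q q' by simp
  then show "b div p \<in> tree" using d by (simp add: mem_tree_iff)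
qed

section \<open>The constant W and the valuation of H\<close>

lemma less_power_length_base_digits: "b < p ^ length (base_digits p b)"
proof (induction b rule: less_induct)
  case (less b)
  show ?case
  proof (cases "b < p")
    case True
    then show ?thesis by (subst base_digits.simps) simp
  next
    case False
    then have "b div p < b" using p_ge_2 by (intro div_less_dividend) auto
    from less.IH[OF this] have "b < p ^ length (base_digits p (b div p)) * p"
      using p_pos by (simp add: div_less_iff_less_mult)
    then show ?thesis using False p_ge_2 by (subst base_digits.simps) (simp add: mult.commute)
  qed
qed

text \<open>Each factor of the factorial lies below p^(t + 1), where t + 1 is the digit count of
  \<open>k - 1\<close>. Hence the natural subtraction defining \<open>W\<close> in
  \<open>padic_val_H\<close> is not truncated.\<close>

lemma multiplicity_fact_le:
  "multiplicity p (fact (k - 1) :: nat) \<le> (k - 1) * (length (base_digits p (k - 1)) - 1)"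
proof -
  let ?t = "length (base_digits p (k - 1)) - 1"
  have len: "length (base_digits p (k - 1)) = Suc ?t" by (simp add: Suc_diff_1)
  have "multiplicity p i \<le> ?t" if "i \<in> {1..k - 1}" for i
  proof -
    have "p ^ multiplicity p i \<le> i" using that by (intro dvd_imp_le multiplicity_dvd) auto
    also have "i < p ^ Suc ?t" using that less_power_length_base_digits[of "k - 1"] len by simp
    finally show ?thesis using p_ge_2 by (simp add: power_strict_increasing_iff del: power_Suc)
  qed
  then have "(\<Sum>i=1..k - 1. multiplicity p i) \<le> (\<Sum>i=1..k - 1. ?t)" by (rule sum_mono)
  then show ?thesis by (simp add: fact_prod multiplicity_prod_nat)
qed

lemma padic_val_H:
  assumes n: "prefix (base_digits p (k - 1)) (base_digits p n)"
    and r: "length (base_digits p (k - 1)) \<le> r" "r < length (base_digits p n)"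
  defines "t \<equiv> length (base_digits p (k - 1)) - 1"
  defines "W \<equiv> (k - 1) * t - multiplicity p (fact (k - 1) :: nat)"
  defines "s \<equiv> length (base_digits p n) - 1"
  defines "m \<equiv> n div p ^ (s - r)"
  shows "m \<in> tree \<Longrightarrow> padic_val_rat p (H n k) \<ge> int W + int r - int k * int s + 1"
    and "m \<in> leaves p (k - 1) tree \<Longrightarrow> padic_val_rat p (H n k) = int W + int r - int k * int s"
proof -
  obtain Q where Q: "n div p ^ Q = k - 1"
    using prefix_base_digits_imp_div[OF p_ge_2 n] by blast
  have t: "length (base_digits p (k - 1)) = Suc t" unfolding t_def by (simp add: Suc_diff_1)
  have s: "s = t + Q" unfolding s_def using digits_of_level(2)[OF Q] t by simp
  obtain q' where q': "r = t + Suc q'" using r(1) t by (metis add_Suc_right less_eqE add_Suc)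
  define h where "h = s - r"
  have h: "s = t + Suc q' + h" "Q = Suc q' + h"
    using r(2) q' s unfolding h_def s_def by auto
  have n': "n div p ^ (Suc q' + h) = k - 1" using Q h by simp
  have m: "m div p ^ Suc q' = k - 1"
    unfolding m_def h_def[symmetric] using n' by (simp only: add.commute[of _ h] power_add div_mult2_eq)
  \<comment> \<open>At least one digit follows those of the root, so \<open>n\<close> exceeds
    \<open>k - 1\<close> and \<open>H n k\<close> is nonzero.\<close>
  have "k \<le> n"
  proof -
    have "1 < p ^ Q" using p_ge_2 h by (intro one_less_power) auto
    moreover have "n > 0" using Q k by (intro gr0I) auto
    ultimately have "n div p ^ Q < n" by (rule div_less_dividend)
    then show ?thesis using Q by simp
  qed
  then have nz: "H n k \<noteq> 0" using H_pos[of k n] by simp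
  have W: "int W = int (k - 1) * int t - int (multiplicity p (fact (k - 1) :: nat))"
    unfolding W_def t_def using multiplicity_fact_le by (simp add: of_nat_diff)
  have k1: "int (k - 1) = int k - 1" using k by simp
  \<comment> \<open>\<open>W\<close> is made for this equation: its (k - 1) * t and the t inside
    \<open>r\<close> absorb the k * t inside k * s.\<close>
  have val: "int W + int r - int k * int s = - int (vtop (Suc q')) - int (k * h)"
    unfolding W q' h(1) vtop_def of_nat_add of_nat_mult k1 by (simp add: algebra_simps)
  have iff: "e + (int W + int r - int k * int s) \<le> padic_val_rat p (H n k) \<longleftrightarrow> H m k \<in> pideal (e - int (vtop (Suc q')))"
    if "e \<le> 1" for e
    using H_div_iff[OF n' that] pideal_iff_padic_val[OF nz]
    unfolding val m_def h_def[symmetric] by (simp add: algebra_simps)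
  show "padic_val_rat p (H n k) \<ge> int W + int r - int k * int s + 1" if "m \<in> tree"
    using that iff[of 1] mem_tree_iff[OF m] by simp
  show "padic_val_rat p (H n k) = int W + int r - int k * int s" if "m \<in> leaves p (k - 1) tree"
  proof -
    \<comment> \<open>The parent in the tree gives the bound for \<open>e = 0\<close>;
      \<open>m\<close> outside the tree refutes the one for \<open>e = 1\<close>.\<close>
    have "m div p \<in> tree" "m \<notin> tree" using that unfolding leaves_def by auto
    then show ?thesis
      using iff[of 0] iff[of 1] mem_tree_iff[OF m] child_in_pideal[OF _ m] by simp
  qed
qed

section \<open>The girth\<close>

text \<open>The product of \<open>tops q\<close> has valuation exactly \<open>vtop q\<close>. Thus
  congruences between siblings become congruences modulo p for harmonic sums.\<close>

lemma divide_prod_tops_iff: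
  "x \<in> pideal e \<longleftrightarrow> 1 / of_nat (\<Prod>(tops q)) * x \<in> pideal (e - int (vtop q))"
proof
  define P where "P = \<Prod>(tops q)"
  have P: "P > 0" "multiplicity p P = vtop q"
    unfolding P_def multiplicity_prod_tops using p_pos by (simp_all add: prod_tops)
  from pideal_mult[OF inverse_in_pideal[OF P(1)], of x e]
  show "1 / of_nat (\<Prod>(tops q)) * x \<in> pideal (e - int (vtop q))" if "x \<in> pideal e"
    unfolding P_def[symmetric] using that P(2) by simp
  have "of_nat P \<in> pideal (int (vtop q))"
    using P(2) by (intro of_nat_in_pideal) (metis multiplicity_dvd)
  from pideal_mult[OF this, of "1 / of_nat P * x" "e - int (vtop q)"] P(1)
  show "x \<in> pideal e" if "1 / of_nat (\<Prod>(tops q)) * x \<in> pideal (e - int (vtop q))"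
    using that unfolding P_def[symmetric] by simp
qed

text \<open>The numbers added lie strictly between b p and (b + 1) p, so none is a multiple of
  p.\<close>

lemma sibling_congruence:
  assumes b: "b div p ^ q = k - 1" and c: "c + d < p"
  shows "H (b * p + (c + d)) k - H (b * p + c) k
      - 1 / of_nat (\<Prod>(tops (Suc q))) * (\<Sum>j=1..d. 1 / of_nat (b * p + c + j))
    \<in> pideal (1 - int (vtop (Suc q)))"
proof -
  have "(\<Sum>x\<in>{b * p + c<..b * p + (c + d)}. 1 / of_nat x) =
      (\<Sum>j=1..d. 1 / of_nat (b * p + c + j) :: rat)"
    by (rule sum.reindex_bij_witness[of _ "\<lambda>j. b * p + c + j" "\<lambda>x. x - (b * p + c)"]) auto
  moreover have "(b * p + x) div p ^ Suc q = k - 1" if "x < p" for x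
    using that b p_pos by (simp add: div_mult2_eq)
  moreover have "\<not> p dvd x" if "b * p + c < x" "x \<le> b * p + (c + d)" for x
  proof
    assume "p dvd x"
    then obtain y where y: "x = y * p" by (metis dvdE mult.commute)
    have "b * p < y * p" using that(1) y by linarith
    moreover have "y * p < (b + 1) * p" using that(2) c y by (simp add: distrib_right)
    ultimately have "b < y" "y < b + 1" unfolding mult_less_cancel2 by auto
    then show False by simp
  qed
  ultimately show ?thesis
    using H_add_congruence[of "b * p + c" "Suc q" "b * p + (c + d)"] c by simp
qed

text \<open>Two children at distance \<open>d\<close> make a harmonic window of length
  \<open>d\<close> vanish modulo p, which leaves at most \<open>d - 1\<close> positions for this
  gap. \<open>D\<close> stays free, to be fitted to \<open>p\<close>.\<close>

lemma card_children_bound: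
  assumes b: "b \<in> tree" and D: "D \<le> p"
  shows "card {c. c < p \<and> b * p + c \<in> tree} * D \<le> (p - 1) + D + (\<Sum>d=1..<D. (D - d) * (d - 1))"
proof -
  let ?A = "{c. c < p \<and> b * p + c \<in> tree}"
  obtain q where q: "b div p ^ q = k - 1" using b unfolding tree_def by blast
  have lev: "(b * p + x) div p ^ Suc q = k - 1" if "x < p" for x
    using that q p_pos by (simp add: div_mult2_eq)
  have gap: "card {c. c \<in> ?A \<and> c + d \<in> ?A} \<le> d - 1" if d: "d \<in> {1..<D}" for d
  proof -
    have "(\<Sum>j=1..d. 1 / of_nat (b * p + c + j)) \<in> pideal 1" if "c \<in> ?A" "c + d \<in> ?A" for c
    proof -
      let ?I = "pideal (1 - int (vtop (Suc q)))"
      have "H (b * p + c) k \<in> ?I" "H (b * p + (c + d)) k \<in> ?I"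
        using that mem_tree_iff[OF lev] by auto
      then have "H (b * p + (c + d)) k - H (b * p + c) k \<in> ?I"
        by (intro pideal_diff)
      from pideal_diff[OF this sibling_congruence[OF q, of c d]] that
      have "1 / of_nat (\<Prod>(tops (Suc q))) * (\<Sum>j=1..d. 1 / of_nat (b * p + c + j)) \<in> ?I" by simp
      then show ?thesis using divide_prod_tops_iff by blast
    qed
    then have "card {c. c \<in> ?A \<and> c + d \<in> ?A}
        \<le> card {c. c + d < p \<and> (\<Sum>j=1..d. 1 / of_nat (b * p + c + j)) \<in> pideal 1}"
      by (intro card_mono) (auto intro: finite_subset[of _ "{..<p}"])
    also have "\<dots> \<le> d - 1" using d D by (intro card_harmonic_window_mod) auto
    finally show ?thesis .
  qed
  show ?thesis
  proof (cases "?A = {}")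
    case True
    then show ?thesis by (metis card.empty mult_0 le0)
  next
    case False
    have fin: "finite ?A" by simp
    have "Max ?A \<in> ?A" using fin False by (rule Max_in)
    then have "Max ?A < p" by simp
    then have "Max ?A \<le> p - 1" by simp
    moreover have "(\<Sum>d=1..<D. (D - d) * card {c. c \<in> ?A \<and> c + d \<in> ?A}) \<le> (\<Sum>d=1..<D. (D - d) * (d - 1))"
      by (intro sum_mono mult_le_mono2 gap)
    ultimately show ?thesis using card_gaps_bound[OF fin False, of D] by linarith
  qed
qed

lemma card_children_less_powr:
  assumes "b \<in> tree"
  shows "real (card {c. c < p \<and> b * p + c \<in> tree}) < real p powr 0.835"
proof (cases "p < 11")
  case True
  \<comment> \<open>With \<open>D = 2\<close> the only weighted gap is 1, which never occurs, so
    twice the number of children is at most p + 1.\<close>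
  have "card {c. c < p \<and> b * p + c \<in> tree} * 2 \<le> (p - 1) + 2 + (\<Sum>d=1..<2. (2 - d) * (d - 1))"
    using assms p_ge_2 by (rule card_children_bound)
  moreover have "{1..<2} = {1 :: nat}" by auto
  ultimately show ?thesis using True p_ge_2 by (intro half_Suc_less_powr) auto
next
  case False
  \<comment> \<open>Up to constants, the cube root balances \<open>p / D\<close> against the roughly
    D^2 / 6 contributed by the gaps.\<close>
  define D where "D = (LEAST d. p \<le> d ^ 3)"
  have "p \<le> p ^ 3" using p_pos by (simp add: self_le_power)
  then have D: "p \<le> D ^ 3" "D \<le> p" unfolding D_def by (rule LeastI, rule Least_le)
  have "D > 0" using D(1) p_pos by (intro gr0I) simp
  then have D1: "(D - 1) ^ 3 < p" using not_less_Least[of "D - 1" "\<lambda>d. p \<le> d ^ 3"]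
    unfolding D_def by simp
  show ?thesis
  proof (rule gap_bound_less_powr[OF card_children_bound[OF assms D(2)] _ D1 D(1)])
    show "6 * (\<Sum>d=1..<D. (D - d) * (d - 1)) + (D - 1) = (D - 1) ^ 3"
      using sum_gap_weights[of "D - 1"] \<open>D > 0\<close> by simp
  qed (use False in simp)
qed

text \<open>The residue field at 2 has only one nonzero element.\<close>

lemma pideal_diff_two:
  assumes "p = 2" "x \<in> pideal e" "y \<in> pideal e" "x \<notin> pideal (e + 1)" "y \<notin> pideal (e + 1)"
  shows "x - y \<in> pideal (e + 1)"
proof -
  have odd: "odd a" if "\<not> int p dvd b" "of_int a / of_int b * of_nat p powi e \<notin> pideal (e + 1)" for a b
  proof
    assume "even a"
    then obtain a' where "a = 2 * a'" by blast
    then have "of_int a / of_int b * of_nat p powi e = (of_int a' / of_int b * of_nat p powi (e + 1) :: rat)"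
      using assms(1) by (simp add: power_int_add)
    with that(2) pidealI[OF that(1), of a' "e + 1"] show False by (simp only: not_True_eq_False)
  qed
  obtain a b where x: "\<not> int p dvd b" "b \<noteq> 0" "x = of_int a / of_int b * of_nat p powi e"
    using assms(2) by (rule pidealE)
  obtain c d where y: "\<not> int p dvd d" "d \<noteq> 0" "y = of_int c / of_int d * of_nat p powi e"
    using assms(3) by (rule pidealE)
  have "odd a" "odd c" using odd x y assms(4,5) by auto
  then have "even (a * d - c * b)" using x(1) y(1) assms(1) by simp
  then obtain z where z: "a * d - c * b = 2 * z" by (rule evenE)
  have "x - y = of_int (a * d - c * b) / of_int (b * d) * of_nat p powi e"
    unfolding x(3) y(3) using x(2) y(2) by (simp add: field_simps)
  also have "\<dots> = of_int z / of_int (b * d) * of_nat p powi (e + 1)"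
    unfolding z using assms(1) by (simp add: power_int_add)
  also have "\<dots> \<in> pideal (e + 1)"
    using x(1) y(1) prime_int_p by (intro pidealI) (simp add: prime_dvd_mult_iff)
  finally show ?thesis .
qed

lemma card_children_two:
  assumes p2: "p = 2" and b: "b \<in> tree"
  shows "card {c. c < p \<and> b * p + c \<in> tree} = 1"
proof -
  obtain q where q: "b div p ^ q = k - 1" using b unfolding tree_def by blast
  let ?e = "- int (vtop (Suc q))"
  have lev: "(b * p + x) div p ^ Suc q = k - 1" if "x < p" for x
    using that q p_pos by (simp add: div_mult2_eq)
  have in_e: "H (b * p + c) k \<in> pideal ?e" if "c < p" for c
    using that b by (intro child_in_pideal[OF _ lev]) auto
  have mem: "b * p + c \<in> tree \<longleftrightarrow> H (b * p + c) k \<in> pideal (?e + 1)" if "c < p" for c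
    using mem_tree_iff[OF lev[OF that]] by (simp add: add.commute)
  \<comment> \<open>Modulo \<open>pideal (?e + 1)\<close> the values at the two children differ by
    \<open>?z\<close>, whose valuation is exactly \<open>?e\<close> because 2 b + 1 is odd.\<close>
  let ?x = "H (b * p) k" and ?y = "H (b * p + 1) k"
  let ?u = "1 / of_nat (b * p + 1) :: rat"
  let ?z = "1 / of_nat (\<Prod>(tops (Suc q))) * ?u"
  have x: "?x \<in> pideal ?e" and y: "?y \<in> pideal ?e" using in_e[of 0] in_e[of 1] p2 by auto
  have yxz: "?y - ?x - ?z \<in> pideal (?e + 1)"
    using sibling_congruence[OF q, of 0 1] p2 by (simp add: add.commute)
  have "multiplicity p (b * p + 1) = 0" using p2 by (intro not_dvd_imp_multiplicity_0) simp
  then have "?u \<in> pideal 0" using inverse_in_pideal[of "b * p + 1"] by simp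
  then have z: "?z \<in> pideal ?e" using divide_prod_tops_iff[of ?u 0 "Suc q"] by simp
  have "?u \<notin> pideal 1"
  proof
    assume "?u \<in> pideal 1"
    from pideal_mult[OF this of_int_in_pideal[of "int (b * p + 1)"]] have "of_int 1 \<in> pideal 1"
      by (simp del: of_nat_add of_nat_mult of_nat_Suc add: of_nat_neq_0)
    then show False unfolding of_int_in_pideal_1_iff using p2 by simp
  qed
  then have nz: "?z \<notin> pideal (?e + 1)" using divide_prod_tops_iff[of ?u 1 "Suc q"] by (simp add: add.commute)
  have "?y \<in> pideal (?e + 1) \<longleftrightarrow> ?x \<notin> pideal (?e + 1)"
  proof
    assume y1: "?y \<in> pideal (?e + 1)"
    show "?x \<notin> pideal (?e + 1)"
    proof
      assume "?x \<in> pideal (?e + 1)"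
      from pideal_diff[OF pideal_diff[OF y1 this] yxz] nz show False by simp
    qed
  next
    assume nx: "?x \<notin> pideal (?e + 1)"
    have "- ?z \<notin> pideal (?e + 1)" using nz pideal_uminus[of "- ?z" "?e + 1"] by auto
    from pideal_diff_two[OF p2 x pideal_uminus[OF z] nx this] have "?x + ?z \<in> pideal (?e + 1)" by simp
    from pideal_add[OF yxz this] show "?y \<in> pideal (?e + 1)" by simp
  qed
  then have iff: "b * p + 1 \<in> tree \<longleftrightarrow> b * p + 0 \<notin> tree" using mem[of 0] mem[of 1] p2 by simp
  have "{c. c < p \<and> b * p + c \<in> tree} = (if b * p + 0 \<in> tree then {0} else {1})"
    using iff p2 by (auto simp: less_2_cases_iff)
  then show ?thesis by simp
qed

end

end

section \<open>Girth as a minimum of child counts, and the assembly\<close>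

lemma girth_le:
  assumes "b \<in> T"
  shows "girth p T \<le> card {c. c < p \<and> b * p + c \<in> T}"
proof -
  let ?P = "\<lambda>g. \<forall>b\<in>T. card {c. c < p \<and> b * p + c \<in> T} \<ge> g"
  \<comment> \<open>\<open>GREATEST\<close> needs an admissible value and an upper bound: 0 is
    admissible, and the child count at \<open>b\<close> is a bound.\<close>
  have "?P (GREATEST g. ?P g)"
    by (rule GreatestI_nat[of ?P 0 "card {c. c < p \<and> b * p + c \<in> T}"]) (use assms in auto)
  then show ?thesis using assms unfolding girth_def by blast
qed

theorem theorem2p1:
  fixes p k :: nat
  assumes "prime p" and "k \<ge> 2"
  shows "\<exists>T W::nat. p_tree p (k - 1) T \<and>
    (\<forall>n r. prefix (base_digits p (k - 1)) (base_digits p n) \<and>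
           length (base_digits p (k - 1)) \<le> r \<and> r < length (base_digits p n) \<longrightarrow>
       (let s = length (base_digits p n) - 1; m = n div p ^ (s - r) in
         (m \<in> T \<longrightarrow> padic_val_rat p (H n k) \<ge> int W + int r - int k * int s + 1) \<and>
         (m \<in> leaves p (k - 1) T \<longrightarrow> padic_val_rat p (H n k) = int W + int r - int k * int s))) \<and>
    real (girth p T) < real p powr 0.835 \<and>
    (p = 2 \<longrightarrow> girth p T = 1)"
proof -
  let ?T = "tree p k"
  let ?W = "(k - 1) * (length (base_digits p (k - 1)) - 1) - multiplicity p (fact (k - 1) :: nat)"
  have root: "k - 1 \<in> ?T" using assms by (rule root_in_tree)
  \<comment> \<open>The girth is the least child count over all nodes, so the count at the root
    alone bounds it.\<close>
  have "real (girth p ?T) \<le> real (card {c. c < p \<and> (k - 1) * p + c \<in> ?T})"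
    using girth_le[OF root, of p] by simp
  also have "\<dots> < real p powr 0.835" using assms root by (rule card_children_less_powr)
  finally have less: "real (girth p ?T) < real p powr 0.835" .
  have two: "girth p ?T = 1" if "p = 2"
  proof -
    have "card {c. c < p \<and> b * p + c \<in> ?T} = 1" if "b \<in> ?T" for b
      using card_children_two[OF assms \<open>p = 2\<close> that] .
    then show ?thesis unfolding girth_def
      \<comment> \<open>The root supplies a node; over an empty set every \<open>g\<close> would
        qualify.\<close>
      by (intro Greatest_equality) (use root in auto)
  qed
  show ?thesis
    by (rule exI[of _ ?T], rule exI[of _ ?W], unfold Let_def)
      (use p_tree_tree[OF assms] padic_val_H[OF assms] less two in blast)
qed

end
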